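(* Fix $V_{\sf P}\ge 0$ and $\delta\in[0,1)$, and let $\rho=\frac{1}{1+e+e^{V_{\sf P}+1}}$. Then, as $p\to0$, $$\lim_{p\to0}{\sf Eng}({\sf PEAR})=\frac{1}{1-\delta\rho}\cdot\frac{e^{V_{\sf P}}+e^{-1}}{1+e^{V_{\sf P}}+e^{-1}}+\frac{1}{1-\delta}\cdot\frac{\delta(1-\rho)}{1-\delta\rho}\cdot\frac{2e^{V_{\sf P}}}{1+2e^{V_{\sf P}}},$$ $$\lim_{p\to0}{\sf Util}({\sf PEAR})=\frac{1}{1-\delta}+\frac{1}{1-\delta\rho}\ln\!\left(1+e^{-1}+e^{V_{\sf P}}\right)+\frac{1}{1-\delta}\cdot\frac{\delta(1-\rho)}{1-\delta\rho}\ln\!\left(1+2e^{V_{\sf P}}\right).$$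
   Context: Model. Time $t=0,1,2,\dots$, discount factor $\delta\in[0,1)$. There are two item types, popular ${\sf P}$ and niche ${\sf N}$, each with infinitely many items. At each time $t$ the platform recommends a set $\pi_t$ of two fresh items, each of a chosen type. The user's utility for an item $i$ of type $\tau(i)$ is $u_i=V_{\tau(i)}+\epsilon_i$, and for the outside option $\emptyset$ it is $u_\emptyset=\epsilon_\emptyset$. All noise terms are i.i.d. Gumbel with scale $1$ and mean $0$ (CDF $\exp(-\exp(-(x+\gamma)))$, $\gamma$ the Euler–Mascheroni constant). The user chooses $c_t=\arg\max_{j\in\pi_t\cup\{\emptyset\}}u_j$. $V_{\sf P}$ is a known constant; $V_{\sf N}$ is drawn once for the user, fixed over time, independent of the noise, with $\mathbb P(V_{\sf N}=(1-p)/p)=p$, $\mathbb P(V_{\sf N}=-1)=1-p$, $p\in(0,1)$. ${\sf Eng}(\pi)=\sum_{t\ge0}\delta^t\mathbb P(c_t\ne\emptyset)$, ${\sf Util}(\pi)=\sum_{t\ge0}\delta^t\mathbb E[\max_{j\in\pi_t\cup\{\emptyset\}}u_j]$ (expectations also over $V_{\sf N}$). Policy ${\sf PEAR}$: let $\rho_1=\frac{e^{(1-p)/p}}{1+e^{V_{\sf P}}+e^{(1-p)/p}}$, $\rho_2=\frac{e^{-1}}{1+e^{V_{\sf P}}+e^{-1}}$. Maintain counters $S,F$ (initially $0$) and $p_0=p$. At each time $t$: if $p_t\ge p$, recommend one popular and one niche item; if the chosen item is the niche item increment $S$, otherwise (popular item or outside option chosen) increment $F$. If $p_t<p$, recommend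 two popular items (counters unchanged). Then set $p_{t+1}=\left(1+\frac{1-p}{p}\cdot\frac{\rho_2^S(1-\rho_2)^F}{\rho_1^S(1-\rho_1)^F}\right)^{-1}$. *)

theory Defs
  imports "HOL-Probability.Probability"
begin

text \<open>Standard Gumbel distribution with scale 1 and mean 0, i.e. CDF
  exp(-exp(-(x+gamma))); given by its density w.r.t. Lebesgue measure.\<close>
definition gumbel :: "real measure" where
  "gumbel = density lborel
     (\<lambda>x. ennreal (exp (- (x + euler_mascheroni)) * exp (- exp (- (x + euler_mascheroni)))))"

text \<open>Alternatives of one round: index 0 = outside option, 1 and 2 = the two
  recommended items. The noise vector is i.i.d. Gumbel.\<close>
definition noise :: "(nat \<Rightarrow> real) measure" where
  "noise = PiM {0, 1, 2} (\<lambda>_. gumbel)"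

text \<open>A menu is the pair of deterministic values (V of item 1, V of item 2).\<close>
definition U :: "real \<times> real \<Rightarrow> (nat \<Rightarrow> real) \<Rightarrow> nat \<Rightarrow> real" where
  "U m e j = (if j = 0 then 0 else if j = 1 then fst m else snd m) + e j"

definition choice_prob :: "real \<times> real \<Rightarrow> nat \<Rightarrow> real" where
  "choice_prob m j = measure noise {e \<in> space noise. \<forall>k\<in>{0,1,2}. k \<noteq> j \<longrightarrow> U m e k < U m e j}"

definition engage_prob :: "real \<times> real \<Rightarrow> real" where
  "engage_prob m = measure noise {e \<in> space noise. \<exists>j\<in>{1,2}. U m e 0 < U m e j}"

definition exp_max :: "real \<times> real \<Rightarrow> real" where
  "exp_max m = integral\<^sup>L noise (\<lambda>e. Max (U m e ` {0, 1, 2}))"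

definition VN_high :: "real \<Rightarrow> real" where "VN_high p = (1 - p) / p"
definition VN_low :: real where "VN_low = -1"

definition rho1 :: "real \<Rightarrow> real \<Rightarrow> real" where
  "rho1 p VP = exp ((1 - p) / p) / (1 + exp VP + exp ((1 - p) / p))"
definition rho2 :: "real \<Rightarrow> real" where
  "rho2 VP = exp (-1) / (1 + exp VP + exp (-1))"

text \<open>Posterior p_t as a function of the counters (S, F); p_0 = p.\<close>
definition posterior :: "real \<Rightarrow> real \<Rightarrow> nat \<times> nat \<Rightarrow> real" where
  "posterior p VP sf =
     inverse (1 + (1 - p) / p * (rho2 VP ^ fst sf * (1 - rho2 VP) ^ snd sf)
                               / (rho1 p VP ^ fst sf * (1 - rho1 p VP) ^ snd sf))"

definition explores :: "real \<Rightarrow> real \<Rightarrow> nat \<times> nat \<Rightarrow> bool" where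
  "explores p VP sf \<longleftrightarrow> posterior p VP sf \<ge> p"

definition menu :: "real \<Rightarrow> real \<Rightarrow> real \<Rightarrow> nat \<times> nat \<Rightarrow> real \<times> real" where
  "menu p VP v sf = (if explores p VP sf then (VP, v) else (VP, VP))"

text \<open>One-step transition of the counters for a user with niche value v:
  the niche item (index 2) is chosen with probability choice_prob.\<close>
definition step :: "real \<Rightarrow> real \<Rightarrow> real \<Rightarrow> nat \<times> nat \<Rightarrow> (nat \<times> nat) pmf" where
  "step p VP v sf = (if explores p VP sf then
      map_pmf (\<lambda>b. if b then (Suc (fst sf), snd sf) else (fst sf, Suc (snd sf)))
              (bernoulli_pmf (choice_prob (VP, v) 2))
    else return_pmf sf)"

text \<open>Distribution of the counters at time t, conditionally on V_N = v.\<close>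
definition state :: "real \<Rightarrow> real \<Rightarrow> real \<Rightarrow> nat \<Rightarrow> (nat \<times> nat) pmf" where
  "state p VP v t = ((\<lambda>d. bind_pmf d (step p VP v)) ^^ t) (return_pmf (0, 0))"

definition period_avg :: "real \<Rightarrow> real \<Rightarrow> (real \<times> real \<Rightarrow> real) \<Rightarrow> nat \<Rightarrow> real" where
  "period_avg p VP f t =
     p * measure_pmf.expectation (state p VP (VN_high p) t) (\<lambda>sf. f (menu p VP (VN_high p) sf))
   + (1 - p) * measure_pmf.expectation (state p VP VN_low t) (\<lambda>sf. f (menu p VP VN_low sf))"

definition Eng_PEAR :: "real \<Rightarrow> real \<Rightarrow> real \<Rightarrow> real" where
  "Eng_PEAR p VP \<delta> = (\<Sum>t. \<delta> ^ t * period_avg p VP engage_prob t)"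

definition Util_PEAR :: "real \<Rightarrow> real \<Rightarrow> real \<Rightarrow> real" where
  "Util_PEAR p VP \<delta> = (\<Sum>t. \<delta> ^ t * period_avg p VP exp_max t)"

end

theory Submission
  imports Defs "HOL-Real_Asymp.Real_Asymp"
begin

text \<open>Gumbel noise is max-stable, so one round follows the logit formulas: the maximal utility is a
  shifted Gumbel variable whose mean is the log-sum of exponentials. As \<^term>\<open>p\<close> tends to \<^term>\<open>0::real\<close>,
  a high-value user takes the niche item with probability tending to 1, so a single rejection drives
  the posterior below the prior. A low-value user is therefore shown the niche item exactly until the
  first rejection, that is at time \<^term>\<open>t\<close> with probability \<open>\<rho> ^ t\<close>. High-value users have mass
  \<^term>\<open>p\<close> and contribute only the limit of \<open>p\<close> times their payoff, which is 0 for engagement and 1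
  for utility. Dominated convergence exchanges the limit with the discounted sum.\<close>

section \<open>The Gumbel law and its distribution function\<close>

text \<open>The kernel is the derivative of
  \<open>exp (- (c * exp (- (x + euler_mascheroni)))) / c\<close>. With \<open>c = 1\<close> it is
  the Gumbel density; larger \<open>c\<close> arises when that density is multiplied by the
  distribution functions of rival alternatives.\<close>

lemma gumbel_kernel_integral:
  fixes c :: real
  assumes "c > 0"
  defines "k \<equiv> \<lambda>x. exp (- (x + euler_mascheroni)) * exp (- (c * exp (- (x + euler_mascheroni))))"
  shows "(\<integral>\<^sup>+x\<in>{..<b}. ennreal (k x) \<partial>lborel)
           = ennreal (exp (- (c * exp (- (b + euler_mascheroni)))) / c)"
    and "(\<integral>\<^sup>+x. ennreal (k x) \<partial>lborel) = ennreal (1 / c)"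
proof -
  define F where "F = (\<lambda>x. exp (- (c * exp (- (x + euler_mascheroni)))) / c)"
  have F': "DERIV F x :> k x" for x
    using assms(1) unfolding F_def k_def by (auto intro!: derivative_eq_intros)
  have cont: "isCont k x" for x unfolding k_def by (intro continuous_intros)
  have F_bot: "((F \<circ> real_of_ereal) \<longlongrightarrow> 0) (at_right (-\<infinity>))"
    unfolding ereal_tendsto_simps F_def using assms(1) by real_asymp
  have F_top: "((F \<circ> real_of_ereal) \<longlongrightarrow> 1 / c) (at_left \<infinity>)"
    unfolding ereal_tendsto_simps F_def using assms(1) by real_asymp (simp add: inverse_eq_divide)
  have F_at: "((F \<circ> real_of_ereal) \<longlongrightarrow> F b) (at_left (ereal b))"
    unfolding ereal_tendsto_simps using DERIV_isCont[OF F'[of b]]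
    by (simp add: isCont_def filterlim_at_split)
  have nn: "0 \<le> k x" for x by (simp add: k_def)
  \<comment> \<open>The fundamental theorem of calculus used below yields Bochner integrals;
    nonnegativity of \<open>k\<close> turns them into extended nonnegative ones.\<close>
  have upgrade: "(\<integral>\<^sup>+x\<in>S. ennreal (k x) \<partial>lborel) = ennreal (set_lebesgue_integral lborel S k)"
    if "set_integrable lborel S k" for S
  proof -
    have "(\<integral>\<^sup>+x\<in>S. ennreal (k x) \<partial>lborel) = (\<integral>\<^sup>+x. ennreal (indicator S x * k x) \<partial>lborel)"
      by (intro nn_integral_cong) (simp add: indicator_def)
    also have "\<dots> = ennreal (set_lebesgue_integral lborel S k)"
      using that nn unfolding set_integrable_def set_lebesgue_integral_def
      by (subst nn_integral_eq_integral) auto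
    finally show ?thesis .
  qed
  from interval_integral_FTC_nonneg[where a="-\<infinity>" and b="ereal b" and F=F and f=k, OF _ F' cont _ F_bot F_at] nn
  have 1: "set_integrable lborel {..<b} k" "(LBINT x=-\<infinity>..ereal b. k x) = F b" by auto
  then show "(\<integral>\<^sup>+x\<in>{..<b}. ennreal (k x) \<partial>lborel)
           = ennreal (exp (- (c * exp (- (b + euler_mascheroni)))) / c)"
    using upgrade[OF 1(1)] by (simp add: F_def interval_lebesgue_integral_def)
  from interval_integral_FTC_nonneg[where a="-\<infinity>" and b="\<infinity>" and F=F and f=k, OF _ F' cont _ F_bot F_top] nn
  have 2: "set_integrable lborel UNIV k" "(LBINT x=-\<infinity>..\<infinity>. k x) = 1 / c" by auto
  then show "(\<integral>\<^sup>+x. ennreal (k x) \<partial>lborel) = ennreal (1 / c)"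
    using upgrade[OF 2(1)] by (simp add: interval_lebesgue_integral_def)
qed

definition gumbel_cdf :: "real \<Rightarrow> real" where
  "gumbel_cdf x = exp (- exp (- (x + euler_mascheroni)))"

lemma sets_gumbel [simp, measurable_cong]: "sets gumbel = sets borel"
  and space_gumbel [simp]: "space gumbel = UNIV"
  by (simp_all add: gumbel_def)

interpretation gumbel: prob_space gumbel
proof
  show "emeasure gumbel (space gumbel) = 1"
    using gumbel_kernel_integral(2)[of 1]
    by (simp add: gumbel_def emeasure_density)
qed

interpretation gumbel_power: product_prob_space "\<lambda>_. gumbel" I for I
  by unfold_locales

lemma real_distribution_gumbel: "real_distribution gumbel"
  by unfold_locales auto

lemma emeasure_gumbel_lessThan: "emeasure gumbel {..<x} = ennreal (gumbel_cdf x)"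
  using gumbel_kernel_integral(1)[of 1 x]
  by (simp add: gumbel_def emeasure_density gumbel_cdf_def)

lemma measure_gumbel_lessThan: "measure gumbel {..<x} = gumbel_cdf x"
  using emeasure_gumbel_lessThan[of x] by (simp add: measure_def gumbel_cdf_def)

text \<open>The law has no atoms. Strict choice events lead to open half-lines, whereas
  \<open>cdf\<close> is defined by closed ones.\<close>

lemma measure_gumbel_atMost: "measure gumbel {..x} = gumbel_cdf x"
proof -
  have "emeasure gumbel {x} = 0"
    by (simp add: gumbel_def emeasure_density nn_integral_indicator_singleton)
  then have "measure gumbel ({..<x} \<union> {x}) = measure gumbel {..<x}"
    by (intro measure_Un_null_set) (auto simp: null_sets_def)
  moreover have "{..<x} \<union> {x} = {..x}" by auto
  ultimately show ?thesis by (simp add: measure_gumbel_lessThan)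
qed

text \<open>The integrand is the \<open>c\<close>-th power of \<open>gumbel_cdf\<close>; multiplying
  it by the density raises the rate in the exponent from \<open>c\<close> to
  \<open>1 + c\<close>.\<close>

lemma nn_integral_gumbel_cdf_power:
  assumes "c \<ge> 0"
  shows "(\<integral>\<^sup>+x. ennreal (exp (- (c * exp (- (x + euler_mascheroni))))) \<partial>gumbel) = ennreal (1 / (1 + c))"
proof -
  have "(\<integral>\<^sup>+x. ennreal (exp (- (c * exp (- (x + euler_mascheroni))))) \<partial>gumbel)
    = (\<integral>\<^sup>+x. ennreal (exp (- (x + euler_mascheroni)) * exp (- ((1 + c) * exp (- (x + euler_mascheroni))))) \<partial>lborel)"
    unfolding gumbel_def
    by (subst nn_integral_density)
       (auto intro!: nn_integral_cong simp: ennreal_mult[symmetric] exp_add[symmetric] algebra_simps)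
  also have "\<dots> = ennreal (1 / (1 + c))"
    using assms by (intro gumbel_kernel_integral(2)) auto
  finally show ?thesis .
qed

section \<open>Logit probabilities from Gumbel noise\<close>

text \<open>Condition on the noise \<open>y\<close> of \<open>j\<close>. The rivals in
  \<open>I\<close> are independent, and shifting the argument of \<open>gumbel_cdf\<close> only
  rescales the exponent, so their product is the \<open>c\<close>-th power of
  \<open>gumbel_cdf y\<close>, where \<open>c\<close> is the total weight of the rivals relative to
  \<open>j\<close>. Integrating over \<open>y\<close> gives \<open>1 / (1 + c)\<close>.\<close>

theorem gumbel_race:
  fixes v :: "'i \<Rightarrow> real"
  assumes I: "finite I" "j \<notin> I"
  defines "M \<equiv> PiM (insert j I) (\<lambda>_. gumbel)"
  shows "measure M {e \<in> space M. \<forall>k\<in>I. v k + e k < v j + e j}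
           = exp (v j) / (\<Sum>k\<in>insert j I. exp (v k))"
proof -
  define A where "A = {e \<in> space M. \<forall>k\<in>I. v k + e k < v j + e j}"
  define c where "c = (\<Sum>k\<in>I. exp (v k - v j))"
  have [measurable]: "A \<in> sets M"
    unfolding A_def M_def using I(1) by measurable
  have inner: "(\<integral>\<^sup>+x. indicator A (x(j := y)) \<partial>PiM I (\<lambda>_. gumbel))
     = ennreal (exp (- (c * exp (- (y + euler_mascheroni)))))" for y
  proof -
    have "(\<integral>\<^sup>+x. indicator A (x(j := y)) \<partial>PiM I (\<lambda>_. gumbel))
       = (\<integral>\<^sup>+x. indicator (\<Pi>\<^sub>E k\<in>I. {..<v j + y - v k}) x \<partial>PiM I (\<lambda>_. gumbel))"
    proof (rule nn_integral_cong)
      fix x assume "x \<in> space (PiM I (\<lambda>_. gumbel))"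
      then have "x(j := y) \<in> A \<longleftrightarrow> x \<in> (\<Pi>\<^sub>E k\<in>I. {..<v j + y - v k})"
        using I(2) by (auto simp: A_def M_def space_PiM PiE_def Pi_def extensional_def algebra_simps)
      then show "indicator A (x(j := y)) = (indicator (\<Pi>\<^sub>E k\<in>I. {..<v j + y - v k}) x :: ennreal)"
        by (simp add: indicator_def)
    qed
    also have "\<dots> = emeasure (PiM I (\<lambda>_. gumbel)) (\<Pi>\<^sub>E k\<in>I. {..<v j + y - v k})"
      using I(1) by (intro nn_integral_indicator sets_PiM_I_finite) auto
    also have "\<dots> = (\<Prod>k\<in>I. ennreal (gumbel_cdf (v j + y - v k)))"
      using I(1) by (subst gumbel_power.emeasure_PiM) (auto simp: emeasure_gumbel_lessThan)
    also have "\<dots> = ennreal (\<Prod>k\<in>I. gumbel_cdf (v j + y - v k))"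
      by (simp add: prod_ennreal gumbel_cdf_def)
    also have "(\<Prod>k\<in>I. gumbel_cdf (v j + y - v k)) = exp (- (c * exp (- (y + euler_mascheroni))))"
      using I(1)
      by (simp add: gumbel_cdf_def exp_sum[symmetric] c_def sum_distrib_left sum_negf exp_add[symmetric] algebra_simps)
    finally show ?thesis .
  qed
  have "c \<ge> 0" by (simp add: c_def sum_nonneg)
  have "emeasure M A = (\<integral>\<^sup>+e. indicator A e \<partial>M)" by simp
  also have "\<dots> = (\<integral>\<^sup>+y. (\<integral>\<^sup>+x. indicator A (x(j := y)) \<partial>PiM I (\<lambda>_. gumbel)) \<partial>gumbel)"
    unfolding M_def
  proof (rule gumbel_power.product_nn_integral_insert_rev[OF I])
    show "indicator A \<in> borel_measurable (PiM (insert j I) (\<lambda>_. gumbel))"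
      using \<open>A \<in> sets M\<close> unfolding M_def by measurable
  qed
  also have "\<dots> = ennreal (1 / (1 + c))"
    unfolding inner by (rule nn_integral_gumbel_cdf_power[OF \<open>c \<ge> 0\<close>])
  finally have "measure M A = 1 / (1 + c)"
    using \<open>c \<ge> 0\<close> by (simp add: measure_def)
  moreover have "(\<Sum>k\<in>insert j I. exp (v k)) = exp (v j) * (1 + c)"
    using I by (simp add: c_def sum_distrib_left algebra_simps exp_add[symmetric])
  ultimately show ?thesis by (simp add: A_def)
qed

section \<open>The mean of the Gumbel law\<close>

text \<open>If \<open>T\<close> is a unit exponential, then
  \<open>- ln T - euler_mascheroni \<le> x\<close> means
  \<open>T \<ge> exp (- (x + euler_mascheroni))\<close>, an event of probability
  \<open>gumbel_cdf x\<close>. This substitution turns moments of the Gumbel law into Gamma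
  integrals.\<close>

lemma gumbel_eq_distr_exponential:
  "gumbel = distr (density lborel (exponential_density 1)) borel (\<lambda>t. - ln t - euler_mascheroni)"
proof -
  define E where "E = density lborel (\<lambda>x. ennreal (exponential_density 1 x))"
  interpret E: prob_space E
    unfolding E_def by (rule prob_space_exponential_density) simp
  have [measurable_cong, simp]: "sets E = sets borel" by (simp add: E_def)
  have [simp]: "space E = UNIV" by (simp add: E_def)
  have dist: "distributed E lborel (\<lambda>x. x) (exponential_density 1)"
    by (auto simp: distributed_def E_def distr_id2)
  have cdf: "measure E {t. - ln t - euler_mascheroni \<le> x} = gumbel_cdf x" for x
  proof -
    define a where "a = exp (- (x + euler_mascheroni))"
    have iff: "- ln t - euler_mascheroni \<le> x \<longleftrightarrow> a \<le> t" if "t > 0" for t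
    proof -
      have "a \<le> t \<longleftrightarrow> - (x + euler_mascheroni) \<le> ln t"
        using that by (simp add: a_def ln_ge_iff)
      then show ?thesis by auto
    qed
    \<comment> \<open>Negative \<open>t\<close> carry no density. The null points excluded are 0,
      which \<open>iff\<close> does not cover, and \<open>a\<close>, where weak and strict
      inequality differ.\<close>
    have "AE t in E. t \<in> {t. - ln t - euler_mascheroni \<le> x} \<longleftrightarrow> t \<in> {a<..}"
      unfolding E_def
      by (subst AE_density, simp, use AE_lborel_singleton[of 0] AE_lborel_singleton[of a] in eventually_elim)
         (auto simp: exponential_density_def iff split: if_splits)
    then have "measure E {t. - ln t - euler_mascheroni \<le> x} = measure E {a<..}"
      by (intro measure_eq_AE) auto
    also have "\<dots> = gumbel_cdf x"
      using E.exponential_distributedD_gt[OF dist, of a]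
      by (simp add: a_def gumbel_cdf_def greaterThan_def)
    finally show ?thesis .
  qed
  have "gumbel = distr E borel (\<lambda>t. - ln t - euler_mascheroni)"
  proof (rule cdf_unique)
    show "real_distribution (distr E borel (\<lambda>t. - ln t - euler_mascheroni))"
      by (intro real_distribution.intro real_distribution_axioms.intro E.prob_space_distr) auto
    show "cdf gumbel = cdf (distr E borel (\<lambda>t. - ln t - euler_mascheroni))"
      by (auto simp: fun_eq_iff cdf_def2 measure_gumbel_atMost measure_distr vimage_def cdf)
  qed (rule real_distribution_gumbel)
  then show ?thesis by (simp add: E_def)
qed

text \<open>Under the exponential substitution \<open>exp (- (s * x))\<close> becomes a constant
  times \<open>t powr s\<close>, which leaves Euler's integral for \<open>Gamma (1 + s)\<close>; it
  converges for \<open>s > -1\<close>.\<close>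

lemma gumbel_laplace_transform:
  assumes "s > -1"
  shows "integrable gumbel (\<lambda>x. exp (- (s * x)))"
    and "integral\<^sup>L gumbel (\<lambda>x. exp (- (s * x))) = exp (s * euler_mascheroni) * Gamma (1 + s)"
proof -
  have "(\<integral>\<^sup>+x. ennreal (exp (- (s * x))) \<partial>gumbel)
     = (\<integral>\<^sup>+t. ennreal (exponential_density 1 t) * ennreal (exp (- (s * (- ln t - euler_mascheroni)))) \<partial>lborel)"
    by (subst gumbel_eq_distr_exponential) (simp add: nn_integral_distr nn_integral_density)
  also have "\<dots> = (\<integral>\<^sup>+t. ennreal (exp (s * euler_mascheroni)) *
      ennreal (indicator {0..} t * t powr (1 + s - 1) / exp t) \<partial>lborel)"
  \<comment> \<open>At \<open>t = 0\<close> the integrands differ: the left one is positive, while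
    \<open>0 powr s\<close> is 0.\<close>
  proof (intro nn_integral_cong_AE, use AE_lborel_singleton[of 0] in eventually_elim)
    case (elim t)
    then show ?case
      by (cases "t < 0")
         (auto simp: exponential_density_def ennreal_mult[symmetric] powr_def exp_add[symmetric]
            exp_diff[symmetric] algebra_simps)
  qed
  also have "\<dots> = ennreal (exp (s * euler_mascheroni) * Gamma (1 + s))"
    using assms Gamma_conv_nn_integral_real[of "1 + s"]
    by (subst nn_integral_cmult) (auto simp: ennreal_mult)
  finally have "integrable gumbel (\<lambda>x. exp (- (s * x))) \<and>
      integral\<^sup>L gumbel (\<lambda>x. exp (- (s * x))) = exp (s * euler_mascheroni) * Gamma (1 + s)"
    using assms by (subst (asm) nn_integral_eq_integrable) (auto simp: Gamma_real_pos less_imp_le)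
  then show "integrable gumbel (\<lambda>x. exp (- (s * x)))"
    and "integral\<^sup>L gumbel (\<lambda>x. exp (- (s * x))) = exp (s * euler_mascheroni) * Gamma (1 + s)"
    by auto
qed

text \<open>The function is dominated through the Laplace transform at \<open>s = 1/2\<close> and
  \<open>s = -1/2\<close>, both above -1, by way of \<open>1 + y \<le> exp y\<close> at
  \<open>y = x / 2\<close> and \<open>y = - x / 2\<close>.\<close>

lemma integrable_gumbel_id: "integrable gumbel (\<lambda>x. x)"
proof (rule Bochner_Integration.integrable_bound)
  show "integrable gumbel (\<lambda>x. 2 * (exp (- ((1/2) * x)) + exp (- ((-1/2) * x))))"
    by (intro integrable_mult_right Bochner_Integration.integrable_add gumbel_laplace_transform(1)) auto
  show "AE x in gumbel. norm x \<le> norm (2 * (exp (- ((1/2) * x)) + exp (- ((-1/2) * x))))"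
  proof (rule AE_I2)
    fix x :: real
    define a b where "a = exp (x / 2)" and "b = exp (- x / 2)"
    have "1 + x / 2 \<le> a" "1 + - x / 2 \<le> b" "0 < a" "0 < b"
      unfolding a_def b_def by (rule exp_ge_add_one_self exp_gt_zero)+
    then have "\<bar>x\<bar> \<le> 2 * (b + a)" by (simp add: abs_le_iff)
    also have "\<dots> = 2 * (exp (- ((1/2) * x)) + exp (- ((-1/2) * x)))"
      by (simp add: a_def b_def)
    finally show "norm x \<le> norm (2 * (exp (- ((1/2) * x)) + exp (- ((-1/2) * x))))"
      unfolding real_norm_def by (rule order_trans[OF _ abs_ge_self])
  qed
qed auto

text \<open>By \<^prop>\<open>1 - s * x \<le> exp (- (s * x))\<close>, the tangent line of the Laplace transform at \<^term>\<open>0::real\<close>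
  has slope minus the mean, and \<^term>\<open>Digamma 1 = - euler_mascheroni\<close> makes that slope vanish.\<close>
lemma gumbel_mean: "integral\<^sup>L gumbel (\<lambda>x. x) = 0"
proof -
  define \<mu> where "\<mu> = integral\<^sup>L gumbel (\<lambda>x. x)"
  define \<phi> where "\<phi> = (\<lambda>s::real. exp (s * euler_mascheroni) * Gamma (1 + s) + s * \<mu>)"
  have ge: "\<phi> 0 \<le> \<phi> s" if "s > -1" for s
  proof -
    have "integral\<^sup>L gumbel (\<lambda>x. 1 - s * x) \<le> integral\<^sup>L gumbel (\<lambda>x. exp (- (s * x)))"
    proof (rule integral_mono)
      show "integrable gumbel (\<lambda>x. 1 - s * x)"
        by (intro Bochner_Integration.integrable_diff integrable_mult_right integrable_gumbel_id) auto
      show "1 - s * x \<le> exp (- (s * x))" for x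
        using exp_ge_add_one_self[of "- (s * x)"] by simp
    qed (rule gumbel_laplace_transform(1)[OF that])
    also have "integral\<^sup>L gumbel (\<lambda>x. 1 - s * x) = 1 - s * \<mu>"
      unfolding \<mu>_def using integrable_gumbel_id
      by (subst Bochner_Integration.integral_diff) (auto simp: gumbel.prob_space[simplified])
    finally show ?thesis
      by (simp add: gumbel_laplace_transform(2)[OF that] \<phi>_def)
  qed
  have "(\<phi> has_real_derivative \<mu>) (at 0)"
    unfolding \<phi>_def
    by (rule derivative_eq_intros refl | simp)+
  then have "\<mu> = 0"
    by (rule DERIV_local_min[where d=1]) (auto intro!: ge)
  then show ?thesis by (simp add: \<mu>_def)
qed

section \<open>Max-stability and the log-sum formula\<close>

text \<open>The distribution function of the maximum is a product of shifted copies of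
  \<open>gumbel_cdf\<close>. The exponents add up, so the product is \<open>gumbel_cdf\<close>
  shifted by \<open>L\<close>; the maximum is distributed as a centred Gumbel variable plus
  \<open>L\<close>.\<close>

theorem gumbel_expected_max:
  fixes v :: "'i \<Rightarrow> real"
  assumes I: "finite I" "I \<noteq> {}"
  shows "integral\<^sup>L (PiM I (\<lambda>_. gumbel)) (\<lambda>e. Max ((\<lambda>j. v j + e j) ` I)) = ln (\<Sum>j\<in>I. exp (v j))"
proof -
  define M where "M = PiM I (\<lambda>_. gumbel)"
  define X where "X = (\<lambda>e. Max ((\<lambda>j. v j + e j) ` I))"
  define L where "L = ln (\<Sum>j\<in>I. exp (v j))"
  have pos: "(\<Sum>j\<in>I. exp (v j)) > 0" using I by (intro sum_pos) auto
  interpret M: prob_space M unfolding M_def by (rule gumbel_power.P.prob_space_axioms)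
  interpret fin: finite_product_prob_space "\<lambda>_. gumbel" I by unfold_locales (rule I(1))
  have [measurable]: "X \<in> borel_measurable M"
    unfolding X_def M_def by (intro borel_measurable_Max I) measurable
  have "distr M borel X = distr gumbel borel (\<lambda>x. x + L)"
  proof (rule cdf_unique)
    show "real_distribution (distr M borel X)" "real_distribution (distr gumbel borel (\<lambda>x. x + L))"
      by (intro real_distribution.intro real_distribution_axioms.intro
            M.prob_space_distr gumbel.prob_space_distr; simp)+
    have "measure M (X -` {..x} \<inter> space M) = measure gumbel {..x - L}" for x
    proof -
      have "X -` {..x} \<inter> space M = (\<Pi>\<^sub>E j\<in>I. {..x - v j})"
      proof -
        have "X e \<le> x \<longleftrightarrow> (\<forall>j\<in>I. e j \<le> x - v j)" for e
          using I unfolding X_def by (subst Max_le_iff) (auto simp: algebra_simps)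
        then show ?thesis by (auto simp: M_def space_PiM PiE_iff)
      qed
      then have "measure M (X -` {..x} \<inter> space M) = (\<Prod>j\<in>I. gumbel_cdf (x - v j))"
        by (simp add: M_def fin.prob_times measure_gumbel_atMost)
      also have "\<dots> = exp (- ((\<Sum>j\<in>I. exp (v j)) * exp (- (x + euler_mascheroni))))"
        using I(1)
        by (simp add: gumbel_cdf_def exp_sum[symmetric] sum_distrib_left sum_negf exp_add[symmetric] algebra_simps)
      also have "(\<Sum>j\<in>I. exp (v j)) = exp L" using pos by (simp add: L_def)
      also have "exp (- (exp L * exp (- (x + euler_mascheroni)))) = gumbel_cdf (x - L)"
        by (simp add: gumbel_cdf_def exp_add[symmetric] algebra_simps)
      finally show ?thesis by (simp add: measure_gumbel_atMost)
    qed
    moreover have "(\<lambda>y. y + L) -` {..x} = {..x - L}" for x by auto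
    ultimately show "cdf (distr M borel X) = cdf (distr gumbel borel (\<lambda>x. x + L))"
      by (simp add: fun_eq_iff cdf_def2 measure_distr)
  qed
  then have "integral\<^sup>L (distr M borel X) (\<lambda>x. x) = integral\<^sup>L (distr gumbel borel (\<lambda>x. x + L)) (\<lambda>x. x)"
    by simp
  then have "integral\<^sup>L M X = integral\<^sup>L gumbel (\<lambda>x. x + L)"
    by (simp add: integral_distr)
  also have "\<dots> = L"
    using integrable_gumbel_id
    by (subst Bochner_Integration.integral_add) (auto simp: gumbel_mean gumbel.prob_space[simplified])
  finally show ?thesis by (simp add: M_def X_def L_def)
qed

section \<open>Closed formulas for a single round\<close>

lemma choice_prob_logit:
  "choice_prob m 0 = 1 / (1 + exp (fst m) + exp (snd m))"
  "choice_prob m 1 = exp (fst m) / (1 + exp (fst m) + exp (snd m))"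
  "choice_prob m 2 = exp (snd m) / (1 + exp (fst m) + exp (snd m))"
proof -
  define v where "v = (\<lambda>j::nat. if j = 0 then 0 else if j = 1 then fst m else snd m)"
  have U: "U m e k = v k + e k" for e k by (simp add: U_def v_def)
  have "choice_prob m j = exp (v j) / (\<Sum>k\<in>{0,1,2}. exp (v k))" if "j \<in> {0,1,2}" for j
  proof -
    have ins: "insert j ({0,1,2} - {j}) = {0,1,2}" using that by auto
    have "{e \<in> space noise. \<forall>k\<in>{0,1,2}. k \<noteq> j \<longrightarrow> U m e k < U m e j}
        = {e \<in> space noise. \<forall>k\<in>{0,1,2} - {j}. v k + e k < v j + e j}"
      unfolding U by blast
    then show ?thesis
      using gumbel_race[of "{0,1,2} - {j}" j v] unfolding ins
      by (simp only: choice_prob_def noise_def) simp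
  qed
  from this[of 0] this[of 1] this[of 2] show
    "choice_prob m 0 = 1 / (1 + exp (fst m) + exp (snd m))"
    "choice_prob m 1 = exp (fst m) / (1 + exp (fst m) + exp (snd m))"
    "choice_prob m 2 = exp (snd m) / (1 + exp (fst m) + exp (snd m))"
    by (simp_all add: v_def add.assoc)
qed

text \<open>Strict wins of the three alternatives are disjoint and, by the logit formula, exhaust the
  probability, so ties in the definition of engagement do not matter.\<close>
lemma engage_prob_logit:
  "engage_prob m = (exp (fst m) + exp (snd m)) / (1 + exp (fst m) + exp (snd m))"
proof -
  interpret noise: prob_space noise
    unfolding noise_def by (rule gumbel_power.P.prob_space_axioms)
  define A where "A j = {e \<in> space noise. \<forall>k\<in>{0,1,2}. k \<noteq> j \<longrightarrow> U m e k < U m e j}" for j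
  define B where "B = {e \<in> space noise. \<exists>j\<in>{1,2}. U m e 0 < U m e j}"
  have Um: "(\<lambda>e. U m e k) \<in> borel_measurable noise" if "k \<in> {0,1,2}" for k
    using that unfolding U_def noise_def by measurable
  have A: "A j \<in> sets noise" if "j \<in> {0,1,2}" for j
    using that unfolding A_def by (intro sets.sets_Collect_finite_All' sets.sets_Collect_imp borel_measurable_less Um) auto
  have B: "B \<in> sets noise"
    unfolding B_def by (intro sets.sets_Collect_finite_Ex borel_measurable_less Um) auto
  have win: "U m e k < U m e j" if "e \<in> A j" "k \<in> {0,1,2}" "k \<noteq> j" for e j k
    using that unfolding A_def by blast
  have disj: "A 1 \<inter> A 2 = {}" "A 0 \<inter> B = {}"
  proof -
    have False if "e \<in> A 1" "e \<in> A 2" for e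
      using win[OF that(1), of 2] win[OF that(2), of 1] by simp
    then show "A 1 \<inter> A 2 = {}" by blast
    have False if "e \<in> A 0" "e \<in> B" for e
    proof -
      from that(2) obtain j where "j \<in> {1,2}" "U m e 0 < U m e j" by (auto simp: B_def)
      then show False using win[OF that(1), of j] by auto
    qed
    then show "A 0 \<inter> B = {}" by blast
  qed
  have "measure noise (A 1) + measure noise (A 2) = measure noise (A 1 \<union> A 2)"
    using A disj(1) by (intro noise.finite_measure_Union[symmetric]) simp_all
  also have "\<dots> \<le> measure noise B"
  proof (rule noise.finite_measure_mono[OF _ B])
    have "e \<in> B" if "e \<in> A j" "j \<in> {1,2}" for e j
    proof -
      have "U m e 0 < U m e j" using win[OF that(1), of 0] that(2) by auto
      moreover have "e \<in> space noise" using that(1) by (simp add: A_def)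
      ultimately show ?thesis using that(2) by (auto simp: B_def)
    qed
    then show "A 1 \<union> A 2 \<subseteq> B" by blast
  qed
  finally have ge: "choice_prob m 1 + choice_prob m 2 \<le> engage_prob m"
    by (simp add: choice_prob_def engage_prob_def A_def B_def)
  have "measure noise (A 0) + measure noise B = measure noise (A 0 \<union> B)"
    using A B disj(2) by (intro noise.finite_measure_Union[symmetric]) simp_all
  also have "\<dots> \<le> 1" by simp
  finally have le: "choice_prob m 0 + engage_prob m \<le> 1"
    by (simp add: choice_prob_def engage_prob_def A_def B_def)
  define D where "D = 1 + exp (fst m) + exp (snd m)"
  have "D > 0" by (simp add: D_def add_pos_pos)
  then have "1 / D + exp (fst m) / D + exp (snd m) / D = 1"
    by (simp add: D_def add_divide_distrib[symmetric])
  then show ?thesis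
    using ge le unfolding choice_prob_logit D_def[symmetric] by (simp add: add_divide_distrib)
qed

lemma exp_max_logsum: "exp_max m = ln (1 + exp (fst m) + exp (snd m))"
  using gumbel_expected_max[of "{0,1,2::nat}" "\<lambda>j. if j = 0 then 0 else if j = 1 then fst m else snd m"]
  by (simp add: exp_max_def noise_def U_def add.assoc cong: image_cong)

section \<open>The exploration rule in terms of likelihoods\<close>

lemma rho2_bounds: "0 < rho2 VP" "rho2 VP < 1"
proof -
  have "0 < 1 + exp VP + exp (-1::real)" by (simp add: add_pos_pos)
  then show "0 < rho2 VP" "rho2 VP < 1"
    by (simp_all add: rho2_def add_pos_pos)
qed

lemma rho1_bounds: "0 < rho1 p VP" "rho1 p VP < 1"
proof -
  have "0 < 1 + exp VP + exp ((1 - p) / p)" by (simp add: add_pos_pos)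
  then show "0 < rho1 p VP" "rho1 p VP < 1"
    by (simp_all add: rho1_def add_pos_pos)
qed

lemma rho1_tendsto: "((\<lambda>p. rho1 p VP) \<longlongrightarrow> 1) (at_right 0)"
  unfolding rho1_def by real_asymp

text \<open>The map from \<open>h\<close> to \<open>h / (1 + exp VP + h)\<close> is increasing, and
  the high niche value is nonnegative while the low one is -1.\<close>

lemma rho2_le_rho1:
  assumes "0 < p" "p < 1"
  shows "rho2 VP \<le> rho1 p VP"
proof -
  define h where "h = exp ((1 - p) / p)"
  have "(1 - p) / p \<ge> 0" using assms by simp
  then have "exp (-1) \<le> h" unfolding h_def by (subst exp_le_cancel_iff) linarith
  moreover have "0 < 1 + exp VP + h" "0 < 1 + exp VP + exp (-1)"
    by (simp_all add: add_pos_pos h_def)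
  ultimately show ?thesis
    unfolding rho1_def rho2_def h_def[symmetric]
    by (simp add: divide_le_eq le_divide_eq pos_divide_le_eq pos_le_divide_eq algebra_simps frac_le_eq)
       (simp add: field_simps add_mono mult_mono)
qed

text \<open>By Bayes' rule the posterior reaches the prior exactly when the observed counts are at
  least as likely under the high value as under the low one; the prior odds cancel.\<close>

lemma explores_iff:
  assumes "0 < p" "p < 1"
  shows "explores p VP (s, f) \<longleftrightarrow>
    rho2 VP ^ s * (1 - rho2 VP) ^ f \<le> rho1 p VP ^ s * (1 - rho1 p VP) ^ f"
proof -
  define a where "a = rho2 VP ^ s * (1 - rho2 VP) ^ f"
  define b where "b = rho1 p VP ^ s * (1 - rho1 p VP) ^ f"
  \<comment> \<open>The prior odds against the high value, in terms of which prior and posterior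
    have the same form.\<close>
  define r where "r = (1 - p) / p"
  have "a > 0" "b > 0" "r > 0"
    using rho2_bounds[of VP] rho1_bounds[of p VP] assms by (simp_all add: a_def b_def r_def)
  have p: "p = inverse (1 + r)" using assms by (simp add: r_def field_simps)
  have "explores p VP (s, f) \<longleftrightarrow> inverse (1 + r) \<le> inverse (1 + r * a / b)"
    by (simp add: explores_def posterior_def a_def[symmetric] b_def[symmetric] r_def[symmetric] p[symmetric])
  also have "\<dots> \<longleftrightarrow> 1 + r * a / b \<le> 1 + r"
    using \<open>a > 0\<close> \<open>b > 0\<close> \<open>r > 0\<close> by (intro inverse_le_iff_le) (auto simp: add_pos_pos)
  also have "\<dots> \<longleftrightarrow> a \<le> b"
    using \<open>a > 0\<close> \<open>b > 0\<close> \<open>r > 0\<close> by (simp add: pos_divide_le_eq)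
  finally show ?thesis by (simp add: a_def b_def)
qed

text \<open>Successes alone never speak against the high value, since
  \<open>rho2 VP \<le> rho1 p VP\<close>.\<close>

lemma explores_without_failure:
  assumes "0 < p" "p < 1"
  shows "explores p VP (s, 0)"
  using rho2_le_rho1[OF assms] rho2_bounds[of VP]
  by (simp add: explores_iff[OF assms] power_mono)

text \<open>As \<^term>\<open>p\<close> tends to \<^term>\<open>0::real\<close> a high-value user almost never rejects the niche item, so one
  rejection outweighs any bounded number of earlier successes.\<close>
lemma eventually_not_explores_after_failure:
  "\<forall>\<^sub>F p in at_right 0. \<forall>s<t. \<not> explores p VP (s, 1)"
proof -
  have "((\<lambda>p. 1 - rho1 p VP) \<longlongrightarrow> 1 - 1) (at_right 0)"
    by (intro tendsto_intros rho1_tendsto)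
  moreover have "0 < rho2 VP ^ t * (1 - rho2 VP)"
    using rho2_bounds[of VP] by simp
  \<comment> \<open>The exponent \<open>t\<close> gives a threshold below those of all
    \<open>s < t\<close>, so one neighbourhood of 0 serves every such \<open>s\<close>.\<close>
  ultimately have "\<forall>\<^sub>F p in at_right 0. 1 - rho1 p VP < rho2 VP ^ t * (1 - rho2 VP)"
    by (auto dest: order_tendstoD)
  moreover have "\<forall>\<^sub>F p::real in at_right 0. p \<in> {0<..<1}"
    by (rule eventually_at_right_real) simp
  ultimately show ?thesis
  proof eventually_elim
    case (elim p)
    show ?case
    proof (intro allI impI)
      fix s assume "s < t"
      have "rho1 p VP ^ s * (1 - rho1 p VP) \<le> 1 * (1 - rho1 p VP)"
        using rho1_bounds[of p VP] by (intro mult_right_mono power_le_one) auto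
      also have "\<dots> < rho2 VP ^ t * (1 - rho2 VP)" using elim by simp
      also have "\<dots> \<le> rho2 VP ^ s * (1 - rho2 VP)"
        using rho2_bounds[of VP] \<open>s < t\<close> by (intro mult_right_mono power_decreasing) auto
      finally show "\<not> explores p VP (s, 1)"
        using elim by (simp add: explores_iff)
    qed
  qed
qed

section \<open>The law of the counters and the expected period payoff\<close>

lemma state_Suc: "state p VP v (Suc t) = bind_pmf (state p VP v t) (step p VP v)"
  by (simp add: state_def)

text \<open>At time \<open>t\<close> either all \<open>t\<close> niche items were accepted, or the
  chain is frozen in \<open>(s, 1)\<close> since its first rejection, after \<open>s\<close>
  successes. The second hypothesis stops at \<open>t\<close> because how small \<open>p\<close> must
  be for it depends on \<open>t\<close>.\<close>

lemma state_before_rejection: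
  assumes "\<And>s. explores p VP (s, 0)" and "\<forall>s<t. \<not> explores p VP (s, 1)"
    and q: "choice_prob (VP, v) 2 \<in> {0..1}"
  shows "set_pmf (state p VP v t) \<subseteq> insert (t, 0) ((\<lambda>s. (s, 1)) ` {..<t})
    \<and> pmf (state p VP v t) (t, 0) = choice_prob (VP, v) 2 ^ t"
  using assms(2)
proof (induction t)
  case 0
  show ?case by (simp add: state_def)
next
  case (Suc t)
  define d where "d = state p VP v t"
  have supp: "set_pmf d \<subseteq> insert (t, 0) ((\<lambda>s. (s, 1)) ` {..<t})"
    and mass: "pmf d (t, 0) = choice_prob (VP, v) 2 ^ t"
    using Suc by (auto simp: d_def)
  have step_explore: "set_pmf (step p VP v (t, 0)) \<subseteq> {(Suc t, 0), (t, 1)}"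
    using assms(1) by (auto simp: step_def split: if_splits)
  have step_stay: "step p VP v (s, 1) = return_pmf (s, 1)" if "s < t" for s
    using Suc.prems that by (simp add: step_def)
  have "set_pmf (state p VP v (Suc t)) \<subseteq> insert (Suc t, 0) ((\<lambda>s. (s, 1)) ` {..<Suc t})"
  proof
    fix x assume "x \<in> set_pmf (state p VP v (Suc t))"
    then obtain y where y: "y \<in> set_pmf d" and x: "x \<in> set_pmf (step p VP v y)"
      by (auto simp: state_Suc d_def)
    from y supp consider "y = (t, 0)" | s where "s < t" "y = (s, 1)" by auto
    then show "x \<in> insert (Suc t, 0) ((\<lambda>s. (s, 1)) ` {..<Suc t})"
    proof cases
      case 1
      then show ?thesis using x step_explore by auto
    next
      case 2
      then show ?thesis using x step_stay[of s] by simp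
    qed
  qed
  moreover have "pmf (state p VP v (Suc t)) (Suc t, 0) = choice_prob (VP, v) 2 ^ Suc t"
  proof -
    have inj: "inj (\<lambda>b. if b then (Suc t, 0::nat) else (t, Suc 0))"
      by (auto simp: inj_def)
    have "pmf (step p VP v (t, 0)) (Suc t, 0) = choice_prob (VP, v) 2"
      using assms(1)[of t] q pmf_map_inj'[OF inj, of "bernoulli_pmf (choice_prob (VP, v) 2)" True]
      by (simp add: step_def cong: if_cong)
    \<comment> \<open>Frozen states keep failure count 1, so \<open>(Suc t, 0)\<close> is reached
      from \<open>(t, 0)\<close> only.\<close>
    then have "pmf (step p VP v y) (Suc t, 0) = choice_prob (VP, v) 2 * indicator {(t, 0)} y"
      if "y \<in> set_pmf d" for y
      using supp step_stay that by (auto simp: indicator_def)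
    then have "measure_pmf.expectation d (\<lambda>y. pmf (step p VP v y) (Suc t, 0))
      = measure_pmf.expectation d (\<lambda>y. choice_prob (VP, v) 2 * indicator {(t, 0)} y)"
      by (intro integral_cong_AE) (auto simp: AE_measure_pmf_iff)
    then show ?thesis
      by (simp add: state_Suc pmf_bind d_def[symmetric] mass measure_pmf_single)
  qed
  ultimately show ?case by blast
qed

text \<open>On the support of \<open>state p VP v t\<close> the niche item is shown exactly in
  \<open>(t, 0)\<close>, whose mass is the power of the acceptance probability.\<close>

lemma expectation_menu_eq:
  assumes "\<And>s. explores p VP (s, 0)" and "\<forall>s<t. \<not> explores p VP (s, 1)"
    and "choice_prob (VP, v) 2 \<in> {0..1}"
  shows "measure_pmf.expectation (state p VP v t) (\<lambda>sf. f (menu p VP v sf))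
    = f (VP, VP) + choice_prob (VP, v) 2 ^ t * (f (VP, v) - f (VP, VP))"
proof -
  define d where "d = state p VP v t"
  note st = state_before_rejection[OF assms]
  have "measure_pmf.expectation d (\<lambda>sf. f (menu p VP v sf))
     = measure_pmf.expectation d (\<lambda>sf. f (VP, VP) + (f (VP, v) - f (VP, VP)) * indicator {(t, 0)} sf)"
    using st assms(1,2) unfolding d_def
    by (intro integral_cong_AE) (auto simp: AE_measure_pmf_iff menu_def)
  also have "\<dots> = f (VP, VP) + (f (VP, v) - f (VP, VP)) * pmf d (t, 0)"
    by (subst Bochner_Integration.integral_add)
       (auto simp: measure_pmf_single intro!: measure_pmf.integrable_const_bound[where B=1] split: split_indicator)
  finally show ?thesis using st by (simp add: d_def mult.commute)
qed

text \<open>Only two menus can occur. The bound does not depend on the law \<open>d\<close>, hence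
  is uniform in time, as dominated convergence requires.\<close>

lemma expectation_menu_bound:
  fixes f :: "real \<times> real \<Rightarrow> real"
  shows "\<bar>measure_pmf.expectation d (\<lambda>sf. f (menu p VP v sf))\<bar> \<le> \<bar>f (VP, v)\<bar> + \<bar>f (VP, VP)\<bar>" (is "_ \<le> ?B")
proof -
  have bd: "\<bar>f (menu p VP v sf)\<bar> \<le> ?B" for sf by (auto simp: menu_def)
  have "\<bar>measure_pmf.expectation d (\<lambda>sf. f (menu p VP v sf))\<bar>
      \<le> measure_pmf.expectation d (\<lambda>sf. \<bar>f (menu p VP v sf)\<bar>)"
    by (rule integral_abs_bound)
  also have "\<dots> \<le> measure_pmf.expectation d (\<lambda>_. ?B)"
    using bd by (intro integral_mono measure_pmf.integrable_const_bound[where B="?B"]) auto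
  finally show ?thesis by simp
qed

section \<open>The limit of the discounted sum\<close>

text \<open>An abstract payoff \<open>f\<close> covers engagement and utility at once. They differ
  in \<open>H\<close>, the limiting contribution per period of the high-value users: their mass
  \<open>p\<close> vanishes, but their payoff may diverge.\<close>

theorem discounted_period_avg_tendsto:
  fixes f :: "real \<times> real \<Rightarrow> real"
  assumes \<delta>: "0 \<le> \<delta>" "\<delta> < 1"
    and high: "\<And>p. choice_prob (VP, VN_high p) 2 = rho1 p VP"
    and low: "choice_prob (VP, VN_low) 2 = rho2 VP"
    and H: "((\<lambda>p. p * f (VP, VN_high p)) \<longlongrightarrow> H) (at_right 0)"
  shows "((\<lambda>p. \<Sum>t. \<delta> ^ t * period_avg p VP f t) \<longlongrightarrow>
     1 / (1 - \<delta>) * H + 1 / (1 - \<delta> * rho2 VP) * f (VP, VN_low)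
     + 1 / (1 - \<delta>) * (\<delta> * (1 - rho2 VP) / (1 - \<delta> * rho2 VP)) * f (VP, VP)) (at_right 0)"
proof -
  define \<rho> where "\<rho> = rho2 VP"
  have \<rho>: "0 < \<rho>" "\<rho> < 1" using rho2_bounds by (auto simp: \<rho>_def)
  \<comment> \<open>The limiting payoff of period \<open>t\<close>: low-value users are still shown
    the niche item with probability \<open>\<rho> ^ t\<close> and otherwise see two popular
    items.\<close>
  define b where "b t = H + f (VP, VP) + \<rho> ^ t * (f (VP, VN_low) - f (VP, VP))" for t
  \<comment> \<open>Near 0 the term \<open>p * f (VP, VN_high p)\<close> is below
    \<open>\<bar>H\<bar> + 1\<close> in absolute value; the other summands come from
    \<open>expectation_menu_bound\<close> with the weights \<open>p\<close> and \<open>1 - p\<close>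
    bounded by 1.\<close>
  define K where "K = \<bar>H\<bar> + 1 + \<bar>f (VP, VP)\<bar> + (\<bar>f (VP, VN_low)\<bar> + \<bar>f (VP, VP)\<bar>)"
  have p01: "\<forall>\<^sub>F p::real in at_right 0. p \<in> {0<..<1}"
    by (rule eventually_at_right_real) simp
  have lim: "((\<lambda>p. period_avg p VP f t) \<longlongrightarrow> b t) (at_right 0)" for t
  proof -
    \<comment> \<open>The weight \<open>p\<close> is multiplied in, because only the product
      \<open>p * f (VP, VN_high p)\<close> is assumed to converge.\<close>
    have "\<forall>\<^sub>F p in at_right 0. p * f (VP, VP) + rho1 p VP ^ t * (p * f (VP, VN_high p) - p * f (VP, VP))
       + (1 - p) * (f (VP, VP) + \<rho> ^ t * (f (VP, VN_low) - f (VP, VP))) = period_avg p VP f t"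
      using eventually_not_explores_after_failure[of t VP] p01
    proof eventually_elim
      case (elim p)
      then show ?case
        using rho1_bounds[of p VP] rho2_bounds[of VP]
        by (simp add: period_avg_def expectation_menu_eq explores_without_failure high low \<rho>_def algebra_simps)
    qed
    moreover have "((\<lambda>p. p * f (VP, VP) + rho1 p VP ^ t * (p * f (VP, VN_high p) - p * f (VP, VP))
       + (1 - p) * (f (VP, VP) + \<rho> ^ t * (f (VP, VN_low) - f (VP, VP)))) \<longlongrightarrow>
       0 * f (VP, VP) + 1 ^ t * (H - 0 * f (VP, VP))
       + (1 - 0) * (f (VP, VP) + \<rho> ^ t * (f (VP, VN_low) - f (VP, VP)))) (at_right 0)"
      by (intro tendsto_intros rho1_tendsto H)
    ultimately show ?thesis
      by (subst (asm) tendsto_cong) (simp_all add: b_def algebra_simps)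
  qed
  have "\<forall>\<^sub>F p in at_right 0. \<bar>p * f (VP, VN_high p)\<bar> < \<bar>H\<bar> + 1"
    using order_tendstoD(2)[OF tendsto_rabs[OF H], of "\<bar>H\<bar> + 1"] by simp
  with p01 have bound: "\<forall>\<^sub>F p in at_right 0. \<forall>t. \<bar>period_avg p VP f t\<bar> \<le> K"
  proof eventually_elim
    case (elim p)
    show ?case
    proof
      fix t
      have "\<bar>period_avg p VP f t\<bar> \<le> p * (\<bar>f (VP, VN_high p)\<bar> + \<bar>f (VP, VP)\<bar>)
          + (1 - p) * (\<bar>f (VP, VN_low)\<bar> + \<bar>f (VP, VP)\<bar>)"
        using elim unfolding period_avg_def
        by (intro order_trans[OF abs_triangle_ineq] add_mono)
           (auto simp: abs_mult intro!: mult_left_mono expectation_menu_bound)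
      also have "\<dots> \<le> K"
        using elim mult_left_le_one_le[of "\<bar>f (VP, VP)\<bar>" p]
          mult_left_le_one_le[of "\<bar>f (VP, VN_low)\<bar> + \<bar>f (VP, VP)\<bar>" "1 - p"]
        by (simp add: K_def abs_mult distrib_left)
      finally show "\<bar>period_avg p VP f t\<bar> \<le> K" .
    qed
  qed
  have "((\<lambda>p. \<Sum>t. \<delta> ^ t * period_avg p VP f t) \<longlongrightarrow> (\<Sum>t. \<delta> ^ t * b t)) (at_right 0)"
  proof (rule tannerys_theorem[where M="\<lambda>t. \<delta> ^ t * K", THEN conjunct2, THEN conjunct2])
    show "((\<lambda>p. \<delta> ^ t * period_avg p VP f t) \<longlongrightarrow> \<delta> ^ t * b t) (at_right 0)" for t
      by (intro tendsto_intros lim)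
    \<comment> \<open>Tannery's theorem wants domination along the product filter;
      \<open>bound\<close> is uniform in \<open>t\<close> and is pulled back along the second
      projection.\<close>
    have "\<forall>\<^sub>F (t, p) in sequentially \<times>\<^sub>F at_right 0. \<forall>t. \<bar>period_avg p VP f t\<bar> \<le> K"
      unfolding case_prod_unfold
      by (rule eventually_compose_filterlim[OF bound filterlim_snd])
    then show "\<forall>\<^sub>F (t, p) in sequentially \<times>\<^sub>F at_right 0. norm (\<delta> ^ t * period_avg p VP f t) \<le> \<delta> ^ t * K"
      by eventually_elim (use \<delta> in \<open>auto simp: abs_mult intro!: mult_left_mono\<close>)
    show "summable (\<lambda>t. \<delta> ^ t * K)"
      using \<delta> by (intro summable_mult2 summable_geometric) auto
  qed simp
  moreover have "(\<lambda>t. \<delta> ^ t * b t) sums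
      (1 / (1 - \<delta>) * (H + f (VP, VP)) + 1 / (1 - \<delta> * \<rho>) * (f (VP, VN_low) - f (VP, VP)))"
  proof -
    have "\<delta> * \<rho> \<le> \<delta>" "\<delta> * \<rho> \<ge> 0" using \<delta> \<rho> by (auto simp: mult_left_le)
    then have "(\<lambda>t. \<delta> ^ t * (H + f (VP, VP)) + (\<delta> * \<rho>) ^ t * (f (VP, VN_low) - f (VP, VP))) sums
      (1 / (1 - \<delta>) * (H + f (VP, VP)) + 1 / (1 - \<delta> * \<rho>) * (f (VP, VN_low) - f (VP, VP)))"
      using \<delta> by (intro sums_add sums_mult2 geometric_sums) auto
    then show ?thesis
      by (simp add: b_def power_mult_distrib algebra_simps)
  qed
  moreover have "1 / (1 - \<delta>) * (H + f (VP, VP)) + 1 / (1 - \<delta> * \<rho>) * (f (VP, VN_low) - f (VP, VP))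
     = 1 / (1 - \<delta>) * H + 1 / (1 - \<delta> * \<rho>) * f (VP, VN_low)
     + 1 / (1 - \<delta>) * (\<delta> * (1 - \<rho>) / (1 - \<delta> * \<rho>)) * f (VP, VP)"
  proof -
    have "\<delta> * \<rho> \<le> \<delta>" using \<delta> \<rho> by (auto simp: mult_left_le)
    then have "1 - \<delta> \<noteq> 0" "1 - \<delta> * \<rho> \<noteq> 0" using \<delta> by auto
    \<comment> \<open>The weight of \<open>f (VP, VP)\<close>: total discounted time less the
      discounted time a low-value user is expected to be shown the niche item.\<close>
    then have "1 / (1 - \<delta>) - 1 / (1 - \<delta> * \<rho>) = 1 / (1 - \<delta>) * (\<delta> * (1 - \<rho>) / (1 - \<delta> * \<rho>))"
      by (simp add: divide_simps) (simp add: algebra_simps)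
    moreover have "X * (H + P) + Y * (L - P) = X * H + Y * L + Z * P" if "X - Y = Z" for X Y Z L P :: real
      by (simp add: that[symmetric] algebra_simps)
    ultimately show ?thesis by blast
  qed
  ultimately show ?thesis by (simp add: sums_iff \<rho>_def)
qed

theorem theorem2:
  fixes VP \<delta> :: real
  assumes "VP \<ge> 0" and "0 \<le> \<delta>" and "\<delta> < 1"
  defines "\<rho> \<equiv> 1 / (1 + exp 1 + exp (VP + 1))"
  shows "((\<lambda>p. Eng_PEAR p VP \<delta>) \<longlongrightarrow>
            1 / (1 - \<delta> * \<rho>) * ((exp VP + exp (-1)) / (1 + exp VP + exp (-1)))
          + 1 / (1 - \<delta>) * (\<delta> * (1 - \<rho>) / (1 - \<delta> * \<rho>)) * (2 * exp VP / (1 + 2 * exp VP)))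
         (at_right 0) \<and>
         ((\<lambda>p. Util_PEAR p VP \<delta>) \<longlongrightarrow>
            1 / (1 - \<delta>) + 1 / (1 - \<delta> * \<rho>) * ln (1 + exp (-1) + exp VP)
          + 1 / (1 - \<delta>) * (\<delta> * (1 - \<rho>) / (1 - \<delta> * \<rho>)) * ln (1 + 2 * exp VP))
         (at_right 0)"
proof -
  \<comment> \<open>Expanding the fraction \<open>rho2 VP\<close> by \<open>exp 1\<close> gives the
    form of \<open>\<rho>\<close> in the theorem.\<close>
  have "exp 1 * (1 + exp VP + exp (-1)) = 1 + exp 1 + exp (VP + 1)"
    by (simp add: exp_add exp_minus algebra_simps)
  then have \<rho>: "rho2 VP = \<rho>"
    unfolding rho2_def \<rho>_def
    by (metis exp_minus inverse_eq_divide divide_divide_eq_left mult.commute)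
  have high: "choice_prob (VP, VN_high p) 2 = rho1 p VP" for p
    by (simp add: choice_prob_logit rho1_def VN_high_def)
  have low: "choice_prob (VP, VN_low) 2 = rho2 VP"
    by (simp add: choice_prob_logit rho2_def VN_low_def)
  note limit = discounted_period_avg_tendsto[OF assms(2,3) high low, unfolded \<rho>]
  have engage: "engage_prob (VP, v) = (exp VP + exp v) / (1 + exp VP + exp v)"
    and maxi: "exp_max (VP, v) = ln (1 + exp VP + exp v)" for v
    by (simp_all add: engage_prob_logit exp_max_logsum)
  \<comment> \<open>Engagement is a probability, so the vanishing mass \<open>p\<close> leaves
    \<open>H = 0\<close>.\<close>
  have "((\<lambda>p. p * engage_prob (VP, VN_high p)) \<longlongrightarrow> 0) (at_right 0)"
    unfolding engage VN_high_def by real_asymp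
  from limit[OF this]
  have "((\<lambda>p. Eng_PEAR p VP \<delta>) \<longlongrightarrow>
            1 / (1 - \<delta> * \<rho>) * ((exp VP + exp (-1)) / (1 + exp VP + exp (-1)))
          + 1 / (1 - \<delta>) * (\<delta> * (1 - \<rho>) / (1 - \<delta> * \<rho>)) * (2 * exp VP / (1 + 2 * exp VP)))
         (at_right 0)"
    by (simp only: Eng_PEAR_def engage VN_low_def mult_zero_right add_0_left mult_2 add.assoc)
  \<comment> \<open>The expected maximum grows like \<open>(1 - p) / p\<close>, so
    \<open>H = 1\<close>; this is the source of the summand
    \<open>1 / (1 - \<delta>)\<close>.\<close>
  moreover have "((\<lambda>p. p * exp_max (VP, VN_high p)) \<longlongrightarrow> 1) (at_right 0)"
    unfolding maxi VN_high_def by real_asymp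
  from limit[OF this]
  have "((\<lambda>p. Util_PEAR p VP \<delta>) \<longlongrightarrow>
            1 / (1 - \<delta>) + 1 / (1 - \<delta> * \<rho>) * ln (1 + exp (-1) + exp VP)
          + 1 / (1 - \<delta>) * (\<delta> * (1 - \<rho>) / (1 - \<delta> * \<rho>)) * ln (1 + 2 * exp VP))
         (at_right 0)"
    by (simp only: Util_PEAR_def maxi VN_low_def mult_1_right mult_2 add_ac)
  ultimately show ?thesis by blast
qed

end
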